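(* Let $P=\{p_1,\ldots,p_n\}$ be a finite poset, let $L=\mathcal{I}(P)$, and let $\beta,\gamma\in L$ with $\beta\le\gamma$. Put $L_1=\{\alpha\in L:\beta\le\alpha\le\gamma\}$. Let $H$ be the affine semigroup associated to $L$, generated by $\{h_\alpha:\alpha\in L\}$, and let $H_1$ be the affine subsemigroup of $H$ generated by $\{h_\alpha:\alpha\in L_1\}$. Then $H_1$ is a homologically pure subsemigroup of $H$.
   Context: $\mathcal{I}(P)$ is the distributive lattice of order ideals (down-closed subsets, including $\emptyset$ and $P$) of $P$, ordered by inclusion. For $\alpha\in\mathcal{I}(P)$, $h_\alpha\in\mathbb{N}^{n+1}$ is the vector whose first entry is $1$ and whose $(i+1)$-th entry is $1$ if $p_i\in\alpha$ and $0$ if $p_i\notin\alpha$ ($1\le i\le n$). Let $H\subset\mathbb{N}^m$ be an affine semigroup (containing $0$) with minimal generators $h_1,\ldots,h_s$. A subsemigroup $H'\subset H$ generated by a subset of $\{h_1,\ldots,h_s\}$ is called homologically pure if for all $h\in H'$ and all $h_i$ with $h-h_i\in H$, one has $h_i\in H'$. *)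

theory Defs
  imports "Jordan_Normal_Form.Matrix"
begin

definition order_ideals :: "'a set \<Rightarrow> ('a \<times> 'a) set \<Rightarrow> 'a set set" where
  "order_ideals P r = {\<alpha>. \<alpha> \<subseteq> P \<and> (\<forall>y\<in>\<alpha>. \<forall>x\<in>P. (x, y) \<in> r \<longrightarrow> x \<in> \<alpha>)}"

text \<open>Vector indices start at \<open>0\<close>, so index \<open>i\<close> with \<open>1 \<le> i \<le> n\<close> belongs to \<open>p i\<close>.\<close>

definition ideal_vec :: "nat \<Rightarrow> (nat \<Rightarrow> 'a) \<Rightarrow> 'a set \<Rightarrow> nat vec" where
  "ideal_vec n p \<alpha> = vec (n + 1) (\<lambda>i. if i = 0 then 1 else if p i \<in> \<alpha> then 1 else 0)"

inductive_set semigroup_gen :: "nat \<Rightarrow> nat vec set \<Rightarrow> nat vec set"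
  for m :: nat and G :: "nat vec set" where
  zero: "0\<^sub>v m \<in> semigroup_gen m G"
| add: "g \<in> G \<Longrightarrow> h \<in> semigroup_gen m G \<Longrightarrow> g + h \<in> semigroup_gen m G"

definition minimal_generators :: "nat \<Rightarrow> nat vec set \<Rightarrow> nat vec set \<Rightarrow> bool" where
  "minimal_generators m H G \<longleftrightarrow>
     finite G \<and> G \<subseteq> carrier_vec m \<and> semigroup_gen m G = H \<and>
     (\<forall>G'. G' \<subset> G \<longrightarrow> semigroup_gen m G' \<noteq> H)"

text \<open>Since \<open>0\<close> is the only invertible vector over the naturals, an affine semigroup \<open>H\<close> has
  exactly one set \<open>G\<close> of minimal generators; the existential quantifier below names it, and
  forces \<open>H\<close> to be an affine semigroup. The difference \<open>h - g\<close> is taken over the integers,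
  since subtraction of \<^typ>\<open>nat vec\<close> truncates.\<close>

definition homologically_pure :: "nat \<Rightarrow> nat vec set \<Rightarrow> nat vec set \<Rightarrow> bool" where
  "homologically_pure m H H' \<longleftrightarrow>
     (\<exists>G. minimal_generators m H G \<and>
          (\<exists>G'\<subseteq>G. H' = semigroup_gen m G') \<and>
          (\<forall>h\<in>H'. \<forall>g\<in>G. map_vec int h - map_vec int g \<in> map_vec int ` H \<longrightarrow> g \<in> H'))"

end

theory Submission
  imports Defs
begin

text \<open>The first coordinate counts the number of generators in a sum. Hence a generator is a sum of
  generators only trivially, which gives minimality. Moreover \<open>h_i \<le> h_0\<close> holds on \<open>H\<close>,
  and on \<open>H\<^sub>1\<close> one has \<open>h_i = h_0\<close> if \<open>p_i \<in> \<beta>\<close> and \<open>h_i = 0\<close> if \<open>p_i \<notin> \<gamma>\<close>.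
  These conditions cut out a face, so they pass from a sum in \<open>H\<close> to its summands.\<close>

lemma semigroup_gen_carrier:
  assumes "G \<subseteq> carrier_vec m" and "h \<in> semigroup_gen m G"
  shows "h \<in> carrier_vec m"
  using assms(2) by induction (use assms(1) in auto)

lemma semigroup_gen_superset:
  assumes "G \<subseteq> carrier_vec m"
  shows "G \<subseteq> semigroup_gen m G"
proof
  fix g assume "g \<in> G"
  then have "g + 0\<^sub>v m \<in> semigroup_gen m G"
    by (intro semigroup_gen.intros)
  with \<open>g \<in> G\<close> assms show "g \<in> semigroup_gen m G" by auto
qed

text \<open>Coordinate \<open>j\<close> is additive and equals 1 on generators, so it is the number
  of summands; a sum with exactly one summand is that generator.\<close>

lemma semigroup_gen_degree_one:
  assumes "G \<subseteq> carrier_vec m" and "j < m" and "\<And>g. g \<in> G \<Longrightarrow> g $ j = 1"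
    and "h \<in> semigroup_gen m G" and "h $ j = 1"
  shows "h \<in> G"
proof -
  \<comment> \<open>The degree 0 claim is what carries the induction: when \<open>g + h\<close> has
    degree 1, the tail \<open>h\<close> has degree 0, hence is zero, and the sum is
    \<open>g\<close>.\<close>
  have "(h $ j = 0 \<longrightarrow> h = 0\<^sub>v m) \<and> (h $ j = 1 \<longrightarrow> h \<in> G)"
    using assms(4)
  proof induction
    case zero
    then show ?case using assms(2) by simp
  next
    case (add g h)
    then have carr: "g \<in> carrier_vec m" "h \<in> carrier_vec m"
      using assms(1) semigroup_gen_carrier by blast+
    then have "(g + h) $ j = Suc (h $ j)"
      using assms(2,3) add.hyps(1) by simp
    then show ?case using add carr by auto
  qed
  then show ?thesis using assms(5) by simp
qed

lemma ideal_vec_carrier: "ideal_vec n p \<alpha> \<in> carrier_vec (n + 1)"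
  by (simp add: ideal_vec_def)

lemma ideal_vec_index:
  "ideal_vec n p \<alpha> $ 0 = 1"
  "\<lbrakk>1 \<le> i; i \<le> n\<rbrakk> \<Longrightarrow> ideal_vec n p \<alpha> $ i = (if p i \<in> \<alpha> then 1 else 0)"
  by (simp_all add: ideal_vec_def)

lemma ideal_vec_image_carrier: "ideal_vec n p ` A \<subseteq> carrier_vec (n + 1)"
  using ideal_vec_carrier by blast

text \<open>A generator has degree 1 in coordinate 0, so any subset of the generators that still
  generates the semigroup must already contain it.\<close>

lemma minimal_generators_ideal_vec:
  assumes "finite A"
  shows "minimal_generators (n + 1) (semigroup_gen (n + 1) (ideal_vec n p ` A)) (ideal_vec n p ` A)"
    (is "minimal_generators ?m _ ?G")
  unfolding minimal_generators_def
proof (intro conjI allI impI notI)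
  fix G' assume sub: "G' \<subset> ?G" and eq: "semigroup_gen ?m G' = semigroup_gen ?m ?G"
  have one: "g $ 0 = 1" if "g \<in> ?G" for g
    using that ideal_vec_index(1) by auto
  have "?G \<subseteq> G'"
  proof
    fix g assume "g \<in> ?G"
    moreover from this have "g \<in> semigroup_gen ?m G'"
      using semigroup_gen_superset[OF ideal_vec_image_carrier] eq by blast
    ultimately show "g \<in> G'"
    proof (intro semigroup_gen_degree_one[of G' ?m 0 g])
      show "G' \<subseteq> carrier_vec ?m"
        using sub ideal_vec_image_carrier[of n p A] by blast
    qed (use sub one in auto)
  qed
  then show False using sub by blast
qed (use assms ideal_vec_image_carrier in blast)+

text \<open>Each generator adds 1 to coordinate 0 and at most 1 to coordinate \<open>i\<close>. The
  bound is later applied to the remainder left after splitting off one generator.\<close>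

lemma semigroup_gen_ideal_vec_le:
  assumes "h \<in> semigroup_gen (n + 1) (ideal_vec n p ` A)" and "1 \<le> i" and "i \<le> n"
  shows "h $ i \<le> h $ 0"
  using assms(1)
proof induction
  case (add g h)
  then have "h \<in> carrier_vec (n + 1)"
    using semigroup_gen_carrier[OF ideal_vec_image_carrier] by blast
  then show ?case using add assms(2,3) by (auto simp: ideal_vec_index)
qed (use assms(2,3) in simp)

lemma semigroup_gen_ideal_vec_eq:
  assumes "h \<in> semigroup_gen (n + 1) (ideal_vec n p ` A)" and "1 \<le> i" and "i \<le> n"
    and "\<And>\<alpha>. \<alpha> \<in> A \<Longrightarrow> p i \<in> \<alpha>"
  shows "h $ i = h $ 0"
  using assms(1)
proof induction
  case (add g h)
  then have "h \<in> carrier_vec (n + 1)"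
    using semigroup_gen_carrier[OF ideal_vec_image_carrier] by blast
  then show ?case using add assms(2-) by (auto simp: ideal_vec_index)
qed (use assms(2,3) in simp)

lemma semigroup_gen_ideal_vec_zero:
  assumes "h \<in> semigroup_gen (n + 1) (ideal_vec n p ` A)" and "1 \<le> i" and "i \<le> n"
    and "\<And>\<alpha>. \<alpha> \<in> A \<Longrightarrow> p i \<notin> \<alpha>"
  shows "h $ i = 0"
  using assms(1)
proof induction
  case (add g h)
  then have "h \<in> carrier_vec (n + 1)"
    using semigroup_gen_carrier[OF ideal_vec_image_carrier] by blast
  then show ?case using add assms(2-) by (auto simp: ideal_vec_index)
qed (use assms(2,3) in simp)

text \<open>The bound \<open>\<beta> \<subseteq> \<alpha>\<close> comes from an equality on the face
  that \<open>k\<close> could not compensate for, and \<open>\<alpha> \<subseteq> \<gamma>\<close>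
  from coordinates that vanish on the face.\<close>

lemma interval_face:
  assumes h: "h \<in> semigroup_gen (n + 1) (ideal_vec n p ` {\<alpha> \<in> L. \<beta> \<subseteq> \<alpha> \<and> \<alpha> \<subseteq> \<gamma>})"
    and k: "k \<in> semigroup_gen (n + 1) (ideal_vec n p ` L)"
    and sum: "h = k + ideal_vec n p \<alpha>"
    and "\<beta> \<subseteq> p ` {1..n}" and "\<alpha> \<subseteq> p ` {1..n}"
  shows "\<beta> \<subseteq> \<alpha> \<and> \<alpha> \<subseteq> \<gamma>"
proof -
  \<comment> \<open>A vector sum takes its dimension from the right summand, here the ideal vector,
    so \<open>i \<le> n\<close> suffices. The case \<open>i = 0\<close> is included.\<close>
  have idx: "h $ i = k $ i + ideal_vec n p \<alpha> $ i" if "i \<le> n" for i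
    using that sum by (simp add: ideal_vec_def)
  have "p i \<in> \<alpha>" if "i \<in> {1..n}" "p i \<in> \<beta>" for i
  proof (rule ccontr)
    \<comment> \<open>Splitting off the generator then lowers coordinate 0 by one but leaves
      coordinate \<open>i\<close> alone, so \<open>k $ i = h $ i = h $ 0 = k $ 0 + 1\<close>, which
      exceeds the bound \<open>k $ 0\<close>.\<close>
    assume "p i \<notin> \<alpha>"
    then have "h $ i = k $ i" and "h $ 0 = k $ 0 + 1"
      using idx[of i] idx[of 0] that by (simp_all add: ideal_vec_index)
    moreover have "h $ i = h $ 0"
      using semigroup_gen_ideal_vec_eq[OF h, of i] that by auto
    moreover have "k $ i \<le> k $ 0"
      using semigroup_gen_ideal_vec_le[OF k, of i] that by auto
    ultimately show False by simp
  qed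
  moreover have "p i \<in> \<gamma>" if "i \<in> {1..n}" "p i \<in> \<alpha>" for i
  proof (rule ccontr)
    \<comment> \<open>Over the naturals a zero entry of the sum forces zero entries in both
      summands, whereas the generator of \<alpha> contributes 1.\<close>
    assume "p i \<notin> \<gamma>"
    then have "h $ i = 0"
      using semigroup_gen_ideal_vec_zero[OF h, of i] that by auto
    then show False
      using idx[of i] that by (simp add: ideal_vec_index)
  qed
  ultimately show ?thesis using assms(4,5) by blast
qed

theorem proposition3p1:
  fixes P :: "'a set" and r :: "('a \<times> 'a) set" and p :: "nat \<Rightarrow> 'a" and n :: nat
    and \<beta> \<gamma> :: "'a set" and L L\<^sub>1 :: "'a set set" and H H\<^sub>1 :: "nat vec set"
  assumes "partial_order_on P r"
    and "bij_betw p {1..n} P"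
    and "L = order_ideals P r"
    and "\<beta> \<in> L" and "\<gamma> \<in> L" and "\<beta> \<subseteq> \<gamma>"
    and "L\<^sub>1 = {\<alpha> \<in> L. \<beta> \<subseteq> \<alpha> \<and> \<alpha> \<subseteq> \<gamma>}"
    and "H = semigroup_gen (n + 1) (ideal_vec n p ` L)"
    and "H\<^sub>1 = semigroup_gen (n + 1) (ideal_vec n p ` L\<^sub>1)"
  shows "homologically_pure (n + 1) H H\<^sub>1"
proof -
  have P: "P = p ` {1..n}"
    using assms(2) by (simp add: bij_betw_def)
  have LP: "L \<subseteq> Pow P"
    using assms(3) by (auto simp: order_ideals_def)
  have "finite L"
    by (rule finite_subset[OF LP]) (simp add: P)
  then have min: "minimal_generators (n + 1) H (ideal_vec n p ` L)"
    unfolding assms(8) by (rule minimal_generators_ideal_vec)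
  have pure: "g \<in> H\<^sub>1"
    if h: "h \<in> H\<^sub>1" and g: "g \<in> ideal_vec n p ` L"
      and diff: "map_vec int h - map_vec int g \<in> map_vec int ` H" for h g
  proof -
    obtain \<alpha> where \<alpha>: "\<alpha> \<in> L" "g = ideal_vec n p \<alpha>" using g by blast
    obtain k where k: "k \<in> H" "map_vec int h - map_vec int g = map_vec int k"
      using diff by blast
    have dims: "dim_vec h = n + 1" "dim_vec k = n + 1" "dim_vec g = n + 1"
      using semigroup_gen_carrier[OF ideal_vec_image_carrier] h k(1) assms(8,9) \<alpha>(2)
        ideal_vec_carrier by (metis carrier_vecD)+
    \<comment> \<open>The entries of \<open>k\<close> are natural, so the integer difference turns
      into a true decomposition of \<open>h\<close> within \<open>H\<close>, as
      \<open>interval_face\<close> requires.\<close>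
    have "h = k + g"
    proof (rule eq_vecI)
      fix i assume "i < dim_vec (k + g)"
      then have i: "i < n + 1" using dims by simp
      have "(map_vec int h - map_vec int g) $ i = map_vec int k $ i"
        using k(2) by simp
      then have "int (h $ i) - int (g $ i) = int (k $ i)"
        using i dims by simp
      then show "h $ i = (k + g) $ i"
        using i dims by simp
    qed (use dims in simp)
    then have "\<beta> \<subseteq> \<alpha> \<and> \<alpha> \<subseteq> \<gamma>"
      using h k(1) \<alpha> LP P assms(4) unfolding assms(7-9)
      by (intro interval_face[of h n p L \<beta> \<gamma> k \<alpha>]) auto
    then have "g \<in> ideal_vec n p ` L\<^sub>1"
      using \<alpha> assms(7) by blast
    then show ?thesis
      using semigroup_gen_superset[OF ideal_vec_image_carrier] assms(9) by blast
  qed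
  have "ideal_vec n p ` L\<^sub>1 \<subseteq> ideal_vec n p ` L"
    using assms(7) by blast
  then show ?thesis
    unfolding homologically_pure_def using min pure assms(9) by blast
qed

end
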